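(* Let $d\ge s\ge1$ be integers, $a,\sigma,m>0$ and $0<\delta<1$. For any $M\in\mathcal M(m,\delta)$, $$\sup_{\theta\in\Theta(s,a)}\mathbb P_\theta(\theta\notin M)\ \ge\ \max\Big(\sup_{\rho\ge a,\ A\le s}G_{TS}(d,A,\rho,m),\ \sup_{\rho>0,\ B\le s}G_{TS}(s,B,\rho,m),\ 1-\frac1{(\Delta_{TS}+1)^s}\Big),$$ where $A,B$ range over positive integers, $$\Delta_{TS}=\Phi\Big(\Phi^{-1}\big(\tfrac{1+\delta}2\big)+\frac a\sigma\Big)-\Phi\Big(-\Phi^{-1}\big(\tfrac{1+\delta}2\big)+\frac a\sigma\Big),$$ $$G_{TS}(d,A,\rho,m)=\frac{A\,[\,g_{TS}(d,A,\rho)-m/\rho\,]_+}{1+A\,[\,g_{TS}(d,A,\rho)-m/\rho\,]_+},$$ $$g_{TS}(d,A,\rho)=\frac{2(d-A)}A\Phi(-D)+\Phi\Big(\frac\rho\sigma+D\Big)-\Phi\Big(\frac\rho\sigma-D\Big),\qquad D=\frac\sigma\rho\cosh^{-1}\Big(\frac{d-A}A\exp\big(\tfrac{\rho^2}{2\sigma^2}\big)\Big),$$ and $G_{TS}(s,B,\rho,m)$ is given by the same formulas with $(d,A)$ replaced by $(s,B)$.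
   Context: $X=(X_1,\dots,X_d)\sim N(\theta,\sigma^2 I_d)$ with $\theta\in\mathbb R^d$ unknown and $\sigma>0$ known; $\mathbb P_\theta,\mathbb E_\theta$ are the corresponding probability and expectation. $\Phi$ is the standard normal c.d.f., $[x]_+=\max(x,0)$, $[d]=\{1,\dots,d\}$, $\|\theta\|_0=|\{j:\theta_j\neq0\}|$. The parameter space is $\Theta(s,a)=\{\theta\in\mathbb R^d:\|\theta\|_0\le s,\ \min_{j:\theta_j\neq0}|\theta_j|\ge a\}$. For a random subset $S=S(X)\subseteq[d]$ and bounds $L_j=L_j(X)$, $U_j=U_j(X)$, $$M(S,U,L)=\{\theta\in\mathbb R^d:\ \theta_j=0\text{ for all }j\in S^c,\ \theta_j\in[L_j,U_j]\text{ for all }j\in S\}.$$ $CI$ is the class of all $M(S,U,L)$ such that for every $j\in[d]$: $L_j,U_j$ depend only on $X_j$, $L_j\le U_j$, and $L_j=U_j=0$ if $j\notin S$. $\mathcal F(\delta)$ is the class of (measurable) random subsets $S=S(X)\subseteq[d]$ such that for every $j$: the event $\{j\in S(X)\}$ depends only on $X_j$, and $\mathbb P_0(j\in S(X))\le1-\delta$, where $\mathbb P_0$ is the probability when $X_j\sim N(0,\sigma^2)$. Finally $$\mathcal M(m,\delta)=\Big\{M(S,U,L)\in CI:\ \sup_{1\le j\le d}\sup_{\theta\in\Theta(s,a)}\mathbb E_\theta(U_j-L_j)\le m,\ S\in\mathcal F(\delta)\Big\}.$$ $\cosh(x)=(e^x+e^{-x})/2$ and $\cosh^{-1}:[1,\infty)\to[0,\infty)$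 is its inverse on the nonnegative half-line; convention: $D=0$ when the argument of $\cosh^{-1}$ is less than $1$. *)

theory Defs
  imports "HOL-Probability.Probability"
begin

text \<open>Points of \<open>\<real>\<^sup>d\<close> are extensional functions on the index set \<open>{1..d}\<close>.\<close>

abbreviation Rd :: "nat \<Rightarrow> (nat \<Rightarrow> real) set"
  where "Rd d \<equiv> {1..d} \<rightarrow>\<^sub>E UNIV"

text \<open>The law \<open>N(\<theta>, \<sigma>\<^sup>2 I\<^sub>d)\<close> of \<open>X\<close>, as the product of its independent marginals
  \<open>N(\<theta>\<^sub>j, \<sigma>\<^sup>2)\<close>. The second parameter of \<open>normal_density\<close> is the standard deviation.\<close>

definition gauss :: "nat \<Rightarrow> real \<Rightarrow> (nat \<Rightarrow> real) \<Rightarrow> (nat \<Rightarrow> real) measure"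
  where "gauss d \<sigma> \<theta> = Pi\<^sub>M {1..d} (\<lambda>j. density lborel (normal_density (\<theta> j) \<sigma>))"

text \<open>The minimum over an empty support counts as \<open>\<infinity>\<close>, so the zero vector belongs to \<open>\<Theta>(s,a)\<close>.\<close>

definition Theta :: "nat \<Rightarrow> nat \<Rightarrow> real \<Rightarrow> (nat \<Rightarrow> real) set"
  where "Theta d s a = {\<theta> \<in> Rd d. card {j \<in> {1..d}. \<theta> j \<noteq> 0} \<le> s \<and>
                                   (\<forall>j\<in>{1..d}. \<theta> j \<noteq> 0 \<longrightarrow> a \<le> \<bar>\<theta> j\<bar>)}"

definition conf_set :: "nat \<Rightarrow> nat set \<Rightarrow> (nat \<Rightarrow> real) \<Rightarrow> (nat \<Rightarrow> real) \<Rightarrow> (nat \<Rightarrow> real) set"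
  where "conf_set d S U L = {\<theta> \<in> Rd d. (\<forall>j\<in>{1..d} - S. \<theta> j = 0) \<and> (\<forall>j\<in>S. \<theta> j \<in> {L j..U j})}"

text \<open>A statistic depends only on \<open>X\<^sub>j\<close> if it is a measurable function of that coordinate;
  \<open>N\<close> is the measurable space of its values.\<close>

definition depends_only_on :: "nat \<Rightarrow> nat \<Rightarrow> 'b measure \<Rightarrow> ((nat \<Rightarrow> real) \<Rightarrow> 'b) \<Rightarrow> bool"
  where "depends_only_on d j N F \<longleftrightarrow> (\<exists>f \<in> measurable borel N. \<forall>x\<in>Rd d. F x = f (x j))"

type_synonym selector = "(nat \<Rightarrow> real) \<Rightarrow> nat set"
type_synonym bounds = "(nat \<Rightarrow> real) \<Rightarrow> nat \<Rightarrow> real"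

text \<open>The class \<open>CI\<close> is kept as a set of triples \<open>(S, U, L)\<close>, because \<open>S\<close>, \<open>U\<close> and \<open>L\<close> are not
  determined by the sets \<open>M(S,U,L)\<close>.\<close>

definition CI :: "nat \<Rightarrow> (selector \<times> bounds \<times> bounds) set"
  where "CI d = {(S, U, L).
    (\<forall>x\<in>Rd d. S x \<subseteq> {1..d}) \<and>
    (\<forall>j\<in>{1..d}.
       depends_only_on d j borel (\<lambda>x. L x j) \<and>
       depends_only_on d j borel (\<lambda>x. U x j) \<and>
       (\<forall>x\<in>Rd d. L x j \<le> U x j \<and> (j \<notin> S x \<longrightarrow> L x j = 0 \<and> U x j = 0)))}"

definition F_class :: "nat \<Rightarrow> real \<Rightarrow> real \<Rightarrow> selector set"
  where "F_class d \<sigma> \<delta> = {S.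
    (\<forall>x\<in>Rd d. S x \<subseteq> {1..d}) \<and>
    (\<forall>j\<in>{1..d}.
       depends_only_on d j (count_space UNIV) (\<lambda>x. j \<in> S x) \<and>
       measure (gauss d \<sigma> (\<lambda>i\<in>{1..d}. 0)) {x \<in> Rd d. j \<in> S x} \<le> 1 - \<delta>)}"

definition M_class ::
  "nat \<Rightarrow> nat \<Rightarrow> real \<Rightarrow> real \<Rightarrow> real \<Rightarrow> real \<Rightarrow> ((nat \<Rightarrow> real) \<Rightarrow> (nat \<Rightarrow> real) set) set"
  where "M_class d s a \<sigma> m \<delta> = {\<lambda>x. conf_set d (S x) (U x) (L x) | S U L.
    (S, U, L) \<in> CI d \<and>
    (SUP j\<in>{1..d}. SUP \<theta>\<in>Theta d s a. \<integral>\<^sup>+x. ennreal (U x j - L x j) \<partial>gauss d \<sigma> \<theta>) \<le> ennreal m \<and>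
    S \<in> F_class d \<sigma> \<delta>}"

definition Phi :: "real \<Rightarrow> real"
  where "Phi = cdf std_normal_distribution"

definition Delta_TS :: "real \<Rightarrow> real \<Rightarrow> real \<Rightarrow> real"
  where "Delta_TS a \<sigma> \<delta> =
    Phi (inv Phi ((1 + \<delta>) / 2) + a / \<sigma>) - Phi (- inv Phi ((1 + \<delta>) / 2) + a / \<sigma>)"

definition D_TS :: "real \<Rightarrow> nat \<Rightarrow> nat \<Rightarrow> real \<Rightarrow> real"
  where "D_TS \<sigma> d A \<rho> =
    (let y = (real d - real A) / real A * exp (\<rho>\<^sup>2 / (2 * \<sigma>\<^sup>2))
     in if y < 1 then 0 else \<sigma> / \<rho> * arcosh y)"

definition g_TS :: "real \<Rightarrow> nat \<Rightarrow> nat \<Rightarrow> real \<Rightarrow> real"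
  where "g_TS \<sigma> d A \<rho> =
    (let D = D_TS \<sigma> d A \<rho>
     in 2 * (real d - real A) / real A * Phi (- D) + Phi (\<rho> / \<sigma> + D) - Phi (\<rho> / \<sigma> - D))"

definition G_TS :: "real \<Rightarrow> nat \<Rightarrow> nat \<Rightarrow> real \<Rightarrow> real \<Rightarrow> real"
  where "G_TS \<sigma> d A \<rho> m =
    (let t = real A * max (g_TS \<sigma> d A \<rho> - m / \<rho>) 0 in t / (1 + t))"

end

theory Submission
  imports Defs
begin

text \<open>Since the interval for the \<open>j\<close>-th coordinate depends on \<open>X\<^sub>j\<close> only, the coverage probability
  at \<open>\<theta>\<close> is the product of coordinatewise coverage probabilities. An interval covering both a base
  point \<open>b\<close> and \<open>b \<plusminus> \<rho>\<close> has length at least \<open>\<rho>\<close>, so up to \<open>m / \<rho>\<close> the indicator of not covering \<open>b\<close>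
  is a test of \<open>b\<close> against \<open>b \<plusminus> \<rho>\<close>, whose weighted error the Neyman--Pearson lemma bounds by
  \<open>g_TS\<close>. The inequality \<open>\<Prod>j. 1 - x j \<le> 1 / (1 + (\<Sum>j. x j))\<close> and the choice of the \<open>A\<close> coordinates
  whose error grows most under the alternative turn these coordinatewise bounds into the bound on the
  joint risk. The first two bounds are the cases \<open>b = 0\<close> with all \<open>d\<close> coordinates and \<open>b = a + \<rho>\<close>
  with \<open>s\<close> coordinates. For the third, covering \<open>\<plusminus>a\<close> requires selecting the coordinate, so the
  Neyman--Pearson lemma applies to the selection event itself.\<close>

section \<open>Normal laws on the line and the distribution function \<open>Phi\<close>\<close>

abbreviation normal_law :: "real \<Rightarrow> real \<Rightarrow> real measure"
  where "normal_law t \<sigma> \<equiv> density lborel (normal_density t \<sigma>)"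

lemma Phi_eq_measure: "Phi x = measure std_normal_distribution {..x}"
  by (simp add: Phi_def cdf_def)

lemma normal_law_affine:
  assumes "\<sigma> > 0" "\<alpha> \<noteq> 0"
  shows "distr (normal_law t \<sigma>) borel (\<lambda>x. \<beta> + \<alpha> * x) = normal_law (\<beta> + \<alpha> * t) (\<bar>\<alpha>\<bar> * \<sigma>)"
proof -
  interpret prob_space "normal_law t \<sigma>"
    using assms by (rule_tac prob_space_normal_density)
  have "distributed (normal_law t \<sigma>) lborel (\<lambda>x. x) (normal_density t \<sigma>)"
    by (auto simp: distributed_def distr_id2)
  from normal_density_affine[OF this assms, of \<beta>]
  have "distr (normal_law t \<sigma>) lborel (\<lambda>x. \<beta> + \<alpha> * x) = normal_law (\<beta> + \<alpha> * t) (\<bar>\<alpha>\<bar> * \<sigma>)"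
    by (simp add: distributed_def)
  then show ?thesis by (simp cong: distr_cong)
qed

lemma measure_normal_law_singleton: "measure (normal_law t \<sigma>) {x} = 0"
proof -
  have "emeasure (normal_law t \<sigma>) {x} = (\<integral>\<^sup>+v. ennreal (normal_density t \<sigma> v) * indicator {x} v \<partial>lborel)"
    by (simp add: emeasure_density)
  also have "\<dots> = (\<integral>\<^sup>+v. ennreal (normal_density t \<sigma> x) * indicator {x} v \<partial>lborel)"
    by (intro nn_integral_cong) (auto split: split_indicator)
  also have "\<dots> = 0" by (simp add: nn_integral_cmult)
  finally show ?thesis by (simp add: measure_def)
qed

lemma measure_normal_law_atMost:
  assumes "\<sigma> > 0"
  shows "measure (normal_law t \<sigma>) {..x} = Phi ((x - t) / \<sigma>)"
proof -
  have "normal_law t \<sigma> = distr std_normal_distribution borel (\<lambda>x. t + \<sigma> * x)"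
    using normal_law_affine[of 1 \<sigma> 0 t] assms by simp
  then have "measure (normal_law t \<sigma>) {..x}
      = measure std_normal_distribution ((\<lambda>x. t + \<sigma> * x) -` {..x} \<inter> space std_normal_distribution)"
    by (simp add: measure_distr)
  also have "(\<lambda>x. t + \<sigma> * x) -` {..x} \<inter> space std_normal_distribution = {..(x - t) / \<sigma>}"
    using assms by (auto simp: field_simps)
  finally show ?thesis by (simp add: Phi_eq_measure)
qed

lemma measure_normal_law_greaterThanLessThan:
  assumes "\<sigma> > 0" "x \<le> y"
  shows "measure (normal_law t \<sigma>) {x<..<y} = Phi ((y - t) / \<sigma>) - Phi ((x - t) / \<sigma>)"
proof -
  interpret prob_space "normal_law t \<sigma>"
    using assms by (rule_tac prob_space_normal_density)
  have "measure (normal_law t \<sigma>) {..y} = measure (normal_law t \<sigma>) ({..x} \<union> {x<..y})"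
    using assms by (intro arg_cong[where f = "measure _"]) auto
  also have "\<dots> = measure (normal_law t \<sigma>) {..x} + measure (normal_law t \<sigma>) {x<..y}"
    by (rule finite_measure_Union) auto
  finally have "Phi ((y - t) / \<sigma>) = Phi ((x - t) / \<sigma>) + measure (normal_law t \<sigma>) {x<..y}"
    using assms by (simp add: measure_normal_law_atMost)
  moreover have "measure (normal_law t \<sigma>) {x<..y} = measure (normal_law t \<sigma>) {x<..<y}"
  proof (cases "x = y")
    case False
    then have "measure (normal_law t \<sigma>) {x<..y} = measure (normal_law t \<sigma>) ({x<..<y} \<union> {y})"
      using assms by (intro arg_cong[where f = "measure _"]) auto
    also have "\<dots> = measure (normal_law t \<sigma>) {x<..<y} + measure (normal_law t \<sigma>) {y}"
      by (rule finite_measure_Union) auto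
    finally show ?thesis by (simp add: measure_normal_law_singleton)
  qed simp
  ultimately show ?thesis by simp
qed

lemma Phi_minus: "Phi (- x) = 1 - Phi x"
proof -
  interpret prob_space std_normal_distribution
    by (rule prob_space_normal_density) simp
  have "std_normal_distribution = distr std_normal_distribution borel (\<lambda>x. - x)"
    using normal_law_affine[of 1 "-1" 0 0] by simp
  then have "Phi (- x) = measure (distr std_normal_distribution borel (\<lambda>x. - x)) {..- x}"
    by (simp add: Phi_eq_measure)
  also have "\<dots> = measure std_normal_distribution {x..}"
    by (subst measure_distr) (auto intro!: arg_cong[where f = "measure _"])
  also have "{x..} = {x} \<union> {x<..}" by auto
  also have "measure std_normal_distribution \<dots>
      = measure std_normal_distribution {x} + measure std_normal_distribution {x<..}"
    by (rule finite_measure_Union) auto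
  also have "{x<..} = space std_normal_distribution - {..x}" by auto
  also have "measure std_normal_distribution \<dots> = 1 - Phi x"
    unfolding Phi_eq_measure by (rule prob_compl) simp
  finally show ?thesis by (simp add: measure_normal_law_singleton)
qed

lemma Phi_mono: "x \<le> y \<Longrightarrow> Phi x \<le> Phi y"
proof -
  interpret real_distribution std_normal_distribution by (rule real_dist_normal_dist)
  show "x \<le> y \<Longrightarrow> Phi x \<le> Phi y" unfolding Phi_def by (rule cdf_nondecreasing)
qed

text \<open>\<open>inv\<close> picks some preimage, so it is enough that \<open>p\<close> lies in
  the range of \<open>Phi\<close>. Continuity follows from the absence of atoms, and the limits 0
  and 1 put \<open>p\<close> between two values of \<open>Phi\<close>.\<close>

lemma Phi_inv_Phi:
  assumes "0 < p" "p < 1"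
  shows "Phi (inv Phi p) = p"
proof -
  interpret real_distribution std_normal_distribution by (rule real_dist_normal_dist)
  have cont: "isCont Phi x" for x
    unfolding Phi_def isCont_cdf by (rule measure_normal_law_singleton)
  have "eventually (\<lambda>x. Phi x > p) at_top"
    using cdf_lim_at_top_prob assms(2) order_tendstoD(1) unfolding Phi_def by blast
  then obtain y where y: "Phi y > p" by (metis eventually_at_top_linorder order_refl)
  have "eventually (\<lambda>x. Phi x < p) at_bot"
    using cdf_lim_at_bot assms(1) order_tendstoD(2) unfolding Phi_def by blast
  then obtain x where x: "Phi x < p" by (metis eventually_at_bot_linorder order_refl)
  have "x \<le> y" using x y Phi_mono[of y x] by linarith
  then have "\<exists>z. x \<le> z \<and> z \<le> y \<and> Phi z = p"
    using x y cont by (intro IVT) auto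
  then have "p \<in> range Phi" by auto
  then show ?thesis by (rule f_inv_into_f)
qed

section \<open>Optimal two-sided tests of a centre against a symmetric pair\<close>

lemma integrable_indicator_normal_density:
  assumes "\<sigma> > 0" "B \<in> sets borel"
  shows "integrable lborel (\<lambda>x. indicator B x * normal_density t \<sigma> x :: real)"
  using integrable_mult_indicator[of B lborel "normal_density t \<sigma>"] assms
    integrable_normal_density[of \<sigma> t] by simp

lemma measure_normal_law_eq_integral:
  assumes "\<sigma> > 0" "B \<in> sets borel"
  shows "measure (normal_law t \<sigma>) B = (\<integral>x. indicator B x * normal_density t \<sigma> x \<partial>lborel)"
proof -
  have "measure (normal_law t \<sigma>) B = (\<integral>x. indicator B x \<partial>normal_law t \<sigma>)"
    using assms by simp
  also have "\<dots> = (\<integral>x. normal_density t \<sigma> x * indicator B x \<partial>lborel)"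
    using assms by (subst integral_density) auto
  finally show ?thesis by (simp add: mult.commute)
qed

text \<open>The factor after 2 is the likelihood ratio of the equal mixture of the two shifted laws
  against the central one. It grows with the distance from \<open>b\<close>, which is why the best
  test is two-sided.\<close>

lemma normal_density_symmetric_mixture:
  assumes "\<sigma> > 0"
  shows "normal_density (b + \<rho>) \<sigma> x + normal_density (b - \<rho>) \<sigma> x
    = 2 * (exp (- \<rho>\<^sup>2 / (2 * \<sigma>\<^sup>2)) * cosh ((x - b) / \<sigma> * (\<rho> / \<sigma>))) * normal_density b \<sigma> x"
proof -
  have "- (x - (b + \<rho>))\<^sup>2 / (2 * \<sigma>\<^sup>2)
      = - (x - b)\<^sup>2 / (2 * \<sigma>\<^sup>2) + - \<rho>\<^sup>2 / (2 * \<sigma>\<^sup>2) + (x - b) / \<sigma> * (\<rho> / \<sigma>)"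
    using assms by (simp add: field_simps power2_eq_square)
  moreover have "- (x - (b - \<rho>))\<^sup>2 / (2 * \<sigma>\<^sup>2)
      = - (x - b)\<^sup>2 / (2 * \<sigma>\<^sup>2) + - \<rho>\<^sup>2 / (2 * \<sigma>\<^sup>2) + - ((x - b) / \<sigma> * (\<rho> / \<sigma>))"
    using assms by (simp add: field_simps power2_eq_square)
  ultimately show ?thesis
    unfolding normal_density_def cosh_def by (simp only: exp_add) (simp add: algebra_simps)
qed

text \<open>The Neyman--Pearson argument: the set \<open>{x. \<sigma> * D \<le> \<bar>x - b\<bar>}\<close> is exactly where the weighted
  null density lies below the mixture of the two alternatives.\<close>

lemma two_sided_neyman_pearson:
  assumes \<sigma>: "\<sigma> > 0" and D: "D \<ge> 0" and B: "B \<in> sets borel"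
    and outer: "\<And>z. D \<le> \<bar>z\<bar> \<Longrightarrow> K \<le> exp (- \<rho>\<^sup>2 / (2 * \<sigma>\<^sup>2)) * cosh (z * (\<rho> / \<sigma>))"
    and inner: "\<And>z. \<bar>z\<bar> < D \<Longrightarrow> exp (- \<rho>\<^sup>2 / (2 * \<sigma>\<^sup>2)) * cosh (z * (\<rho> / \<sigma>)) \<le> K"
  shows "K * (2 * Phi (- D)) - (1 - (Phi (\<rho> / \<sigma> + D) - Phi (\<rho> / \<sigma> - D)))
    \<le> K * measure (normal_law b \<sigma>) B
        - (measure (normal_law (b + \<rho>) \<sigma>) B + measure (normal_law (b - \<rho>) \<sigma>) B) / 2"
proof -
  \<comment> \<open>Up to an additive 1, \<open>V\<close> is the weighted error of the test that
    rejects on its argument: \<open>K\<close> times the false rejection probability plus the average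
    miss probability. \<open>h\<close> is its signed density.\<close>
  define V where "V = (\<lambda>C. K * measure (normal_law b \<sigma>) C
        - (measure (normal_law (b + \<rho>) \<sigma>) C + measure (normal_law (b - \<rho>) \<sigma>) C) / 2)"
  define h where "h = (\<lambda>x. K * normal_density b \<sigma> x
        - (normal_density (b + \<rho>) \<sigma> x + normal_density (b - \<rho>) \<sigma> x) / 2)"
  \<comment> \<open>\<open>D\<close> is measured in units of \<open>\<sigma>\<close>. Removing an
    open interval leaves the boundary in \<open>C\<close>, in agreement with
    \<open>outer\<close>.\<close>
  define C where "C = UNIV - {b - \<sigma> * D <..< b + \<sigma> * D}"
  have C: "C \<in> sets borel" by (simp add: C_def)
  have h: "h x = (K - exp (- \<rho>\<^sup>2 / (2 * \<sigma>\<^sup>2)) * cosh ((x - b) / \<sigma> * (\<rho> / \<sigma>))) * normal_density b \<sigma> x" for x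
    unfolding h_def normal_density_symmetric_mixture[OF \<sigma>] by (simp add: algebra_simps)
  have split: "indicator S x * h x = K * (indicator S x * normal_density b \<sigma> x)
      - (indicator S x * normal_density (b + \<rho>) \<sigma> x + indicator S x * normal_density (b - \<rho>) \<sigma> x) / 2"
    for S x by (simp add: h_def algebra_simps add_divide_distrib)
  have int: "integrable lborel (\<lambda>x. indicator S x * h x)" if "S \<in> sets borel" for S
    unfolding split
    by (intro Bochner_Integration.integrable_diff integrable_mult_right integrable_divide
        Bochner_Integration.integrable_add integrable_indicator_normal_density \<sigma> that)
  have V: "V S = (\<integral>x. indicator S x * h x \<partial>lborel)" if "S \<in> sets borel" for S
    unfolding split V_def
    using integrable_indicator_normal_density[OF \<sigma> that]
    by (simp add: measure_normal_law_eq_integral[OF \<sigma> that])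
  have le: "V C \<le> V B"
    unfolding V[OF C] V[OF B]
  proof (intro integral_mono int C B)
    fix x
    have x: "x \<in> C \<longleftrightarrow> D \<le> \<bar>(x - b) / \<sigma>\<bar>"
      using \<sigma> by (auto simp: C_def field_simps abs_if)
    show "indicator C x * h x \<le> indicator B x * h x"
    proof (cases "x \<in> C")
      case True
      then have "h x \<le> 0" unfolding h
        using outer[of "(x - b) / \<sigma>"] x by (intro mult_nonpos_nonneg) simp_all
      with True show ?thesis by (auto split: split_indicator)
    next
      case False
      then have "h x \<ge> 0" unfolding h
        using inner[of "(x - b) / \<sigma>"] x by (intro mult_nonneg_nonneg) simp_all
      with False show ?thesis by (auto split: split_indicator)
    qed
  qed
  have meas: "measure (normal_law t \<sigma>) C
      = 1 - (Phi ((b - t) / \<sigma> + D) - Phi ((b - t) / \<sigma> - D))" for t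
  proof -
    interpret prob_space "normal_law t \<sigma>" by (rule prob_space_normal_density[OF \<sigma>])
    have "measure (normal_law t \<sigma>) C = 1 - measure (normal_law t \<sigma>) {b - \<sigma> * D <..< b + \<sigma> * D}"
      unfolding C_def using prob_compl[of "{b - \<sigma> * D <..< b + \<sigma> * D}"] by simp
    also have "measure (normal_law t \<sigma>) {b - \<sigma> * D <..< b + \<sigma> * D}
        = Phi ((b + \<sigma> * D - t) / \<sigma>) - Phi ((b - \<sigma> * D - t) / \<sigma>)"
      using \<sigma> D by (intro measure_normal_law_greaterThanLessThan) (auto intro: order_trans[of _ 0])
    also have "(b + \<sigma> * D - t) / \<sigma> = (b - t) / \<sigma> + D" using \<sigma> by (simp add: field_simps)
    also have "(b - \<sigma> * D - t) / \<sigma> = (b - t) / \<sigma> - D" using \<sigma> by (simp add: field_simps)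
    finally show ?thesis .
  qed
  have "measure (normal_law b \<sigma>) C = 2 * Phi (- D)"
    unfolding meas using Phi_minus[of D] by simp
  moreover have "measure (normal_law (b + \<rho>) \<sigma>) C = 1 - (Phi (\<rho> / \<sigma> + D) - Phi (\<rho> / \<sigma> - D))"
    unfolding meas using Phi_minus[of "\<rho> / \<sigma> + D"] Phi_minus[of "\<rho> / \<sigma> - D"] by simp
  moreover have "measure (normal_law (b - \<rho>) \<sigma>) C = 1 - (Phi (\<rho> / \<sigma> + D) - Phi (\<rho> / \<sigma> - D))"
    unfolding meas by simp
  ultimately have "V C = K * (2 * Phi (- D)) - (1 - (Phi (\<rho> / \<sigma> + D) - Phi (\<rho> / \<sigma> - D)))"
    by (simp add: V_def field_simps)
  with le show ?thesis by (simp add: V_def)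
qed

section \<open>From coordinate errors to a joint error\<close>

text \<open>Adding one factor preserves the bound because (1 - x)(1 + x + S) = 1 + S - x(x + S), and
  the subtracted term is nonnegative.\<close>

lemma prod_one_minus_times_one_plus_sum_le:
  fixes f :: "'a \<Rightarrow> real"
  assumes "finite J" "\<And>j. j \<in> J \<Longrightarrow> 0 \<le> f j \<and> f j \<le> 1"
  shows "(\<Prod>j\<in>J. 1 - f j) * (1 + sum f J) \<le> 1"
  using assms
proof (induction J)
  case (insert k J)
  have S: "0 \<le> sum f J" using insert by (intro sum_nonneg) auto
  have "(1 - f k) * (1 + (f k + sum f J)) \<le> 1 + sum f J"
    using S insert.prems[of k] by (simp add: algebra_simps)
  then have "(\<Prod>j\<in>J. 1 - f j) * ((1 - f k) * (1 + (f k + sum f J))) \<le> (\<Prod>j\<in>J. 1 - f j) * (1 + sum f J)"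
    using insert by (intro mult_left_mono prod_nonneg) auto
  with insert show ?case by (simp add: mult.assoc mult.left_commute)
qed simp

text \<open>A deterministic substitute for averaging over a uniformly random
  \<open>k\<close>-subset: discarding a smallest weight never lowers the mean, and this is repeated
  until \<open>k\<close> elements remain.\<close>

lemma exists_subset_sum_ge_average:
  fixes w :: "'a \<Rightarrow> real"
  assumes "finite J" "k \<le> card J"
  obtains T where "T \<subseteq> J" "card T = k" "real k * sum w J \<le> real (card J) * sum w T"
proof -
  have "\<exists>T\<subseteq>J. card T = k \<and> real k * sum w J \<le> real (card J) * sum w T"
    using assms
  proof (induction "card J - k" arbitrary: J)
    case 0
    then show ?case by (intro exI[of _ J]) auto
  next
    case (Suc n)
    then have ne: "J \<noteq> {}" by auto
    obtain i where i: "i \<in> J" "\<And>j. j \<in> J \<Longrightarrow> w i \<le> w j"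
      using Suc.prems(1) ne by (metis arg_min_if_finite(1) arg_min_least)
    have c: "card J = Suc (card (J - {i}))" using card_Suc_Diff1[OF Suc.prems(1) i(1)] by simp
    have "n = card (J - {i}) - k" "k \<le> card (J - {i})" using Suc.hyps(2) c by auto
    with Suc.hyps(1)[of "J - {i}"] Suc.prems obtain T where
      T: "T \<subseteq> J - {i}" "card T = k" "real k * sum w (J - {i}) \<le> real (card (J - {i})) * sum w T"
      by auto
    have sJ: "sum w J = w i + sum w (J - {i})" using i Suc.prems by (simp add: sum.remove)
    have "real k * w i = (\<Sum>j\<in>T. w i)" using T by simp
    also have "\<dots> \<le> sum w T" using T i by (intro sum_mono) auto
    finally have "real k * w i \<le> sum w T" .
    with T sJ c show ?case by (intro exI[of _ T]) (auto simp: algebra_simps)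
  qed
  then show ?thesis using that by blast
qed

text \<open>Here \<open>q\<close> and \<open>r\<close> are the error probabilities of a coordinate at the base point and at
  the alternative; the hypothesis \<open>prod\<close> is the product bound for the configuration \<open>T\<close>.\<close>

lemma product_risk_lower_bound:
  fixes q r :: "'a \<Rightarrow> real"
  assumes J: "finite J" "A \<le> card J" "J \<noteq> {}"
    and q: "\<And>j. j \<in> J \<Longrightarrow> 0 \<le> q j \<and> q j \<le> 1"
    and r: "\<And>j. j \<in> J \<Longrightarrow> 0 \<le> r j \<and> r j \<le> 1"
    and h: "\<And>j. j \<in> J \<Longrightarrow> real A * h \<le> (real (card J) - real A) * q j + real A * r j"
    and prod: "\<And>T. T \<subseteq> J \<Longrightarrow> card T = A \<Longrightarrow> 1 - R \<le> (\<Prod>j\<in>J. 1 - (if j \<in> T then r j else q j))"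
  shows "real A * max h 0 / (1 + real A * max h 0) \<le> R"
proof -
  let ?n = "real (card J)" and ?t = "real A * max h 0"
  \<comment> \<open>Moving the coordinates in \<open>T\<close> to the alternative raises the total
    error at least as much as moving a random \<open>A\<close>-subset would on average.\<close>
  obtain T where T: "T \<subseteq> J" "card T = A"
    "real A * (\<Sum>j\<in>J. r j - q j) \<le> ?n * (\<Sum>j\<in>T. r j - q j)"
    using exists_subset_sum_ge_average[OF J(1,2)] by metis
  define f where "f = (\<lambda>j. if j \<in> T then r j else q j)"
  have f: "0 \<le> f j \<and> f j \<le> 1" if "j \<in> J" for j using q r that by (auto simp: f_def)
  \<comment> \<open>The right-hand side is nonnegative since \<open>A \<le> card J\<close>, so
    \<open>h\<close> may be replaced by its positive part.\<close>
  have t: "?t \<le> (?n - real A) * q j + real A * r j" if "j \<in> J" for j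
    using h[OF that] q[OF that] r[OF that] J(2) by (auto simp: max_def)
  have "?n * ?t = (\<Sum>j\<in>J. ?t)" by simp
  also have "\<dots> \<le> (\<Sum>j\<in>J. (?n - real A) * q j + real A * r j)" by (intro sum_mono t)
  also have "\<dots> = real A * (\<Sum>j\<in>J. r j - q j) + ?n * sum q J"
    by (simp add: sum.distrib sum_distrib_left sum_distrib_right sum_subtractf algebra_simps)
  also have "\<dots> \<le> ?n * (\<Sum>j\<in>T. r j - q j) + ?n * sum q J" using T by simp
  also have "\<dots> = ?n * sum f J"
  proof -
    have "sum f J = sum f T + sum f (J - T)" using J T by (metis add.commute sum.subset_diff)
    also have "\<dots> = sum r T + sum q (J - T)" by (simp add: f_def)
    also have "sum q (J - T) = sum q J - sum q T" using J T by (simp add: sum_diff)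
    finally have "sum f J = (\<Sum>j\<in>T. r j - q j) + sum q J" by (simp add: sum_subtractf)
    then show ?thesis by (simp add: distrib_left)
  qed
  finally have tf: "?t \<le> sum f J" using J by (simp add: card_gt_0_iff)
  have t0: "0 \<le> ?t" by simp
  have "(1 - R) * (1 + ?t) \<le> (\<Prod>j\<in>J. 1 - f j) * (1 + ?t)"
    using prod[OF T(1,2)] t0 by (intro mult_right_mono) (auto simp: f_def)
  also have "\<dots> \<le> (\<Prod>j\<in>J. 1 - f j) * (1 + sum f J)"
    using tf f by (intro mult_left_mono prod_nonneg) auto
  also have "\<dots> \<le> 1" using J f by (rule_tac prod_one_minus_times_one_plus_sum_le) auto
  finally have "?t \<le> R * (1 + ?t)" by (simp add: algebra_simps)
  then show ?thesis using t0 by (simp add: pos_divide_le_eq add_pos_nonneg)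
qed

section \<open>Threshold and error of the optimal test\<close>

lemma cosh_mult_le_cosh_mult:
  fixes c :: real
  assumes "\<bar>y\<bar> \<le> \<bar>z\<bar>" "0 \<le> c"
  shows "cosh (y * c) \<le> cosh (z * c)"
proof -
  have "cosh (\<bar>y\<bar> * c) \<le> cosh (\<bar>z\<bar> * c)"
    using assms by (subst cosh_real_nonneg_le_iff) (auto intro: mult_right_mono)
  moreover have "cosh (\<bar>w\<bar> * c) = cosh (w * c)" for w by (simp add: abs_if)
  ultimately show ?thesis by simp
qed

lemma D_TS_nonneg: "0 < \<sigma> \<Longrightarrow> 0 < \<rho> \<Longrightarrow> 0 \<le> D_TS \<sigma> n A \<rho>"
  by (simp add: D_TS_def Let_def)

text \<open>The weight is the ratio of unmoved to moved coordinates. When \<open>y \<ge> 1\<close>,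
  \<open>D_TS\<close> is the point where the likelihood ratio equals this weight. When
  \<open>y < 1\<close>, the ratio exceeds the weight everywhere, and threshold 0 is the test that
  always rejects.\<close>

lemma g_TS_le_testing_error:
  assumes \<sigma>: "\<sigma> > 0" and \<rho>: "\<rho> > 0" and B: "B \<in> sets borel"
  shows "g_TS \<sigma> n A \<rho> - 1 \<le> (real n - real A) / real A * measure (normal_law b \<sigma>) B
        - (measure (normal_law (b + \<rho>) \<sigma>) B + measure (normal_law (b - \<rho>) \<sigma>) B) / 2"
proof -
  define K where "K = (real n - real A) / real A"
  define y where "y = K * exp (\<rho>\<^sup>2 / (2 * \<sigma>\<^sup>2))"
  define D where "D = D_TS \<sigma> n A \<rho>"
  have D0: "D \<ge> 0" unfolding D_def using \<sigma> \<rho> by (rule D_TS_nonneg)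
  have K: "K = exp (- \<rho>\<^sup>2 / (2 * \<sigma>\<^sup>2)) * y"
    by (simp add: y_def exp_minus field_simps)
  have D: "D = (if y < 1 then 0 else \<sigma> / \<rho> * arcosh y)"
    by (simp add: D_def D_TS_def y_def K_def Let_def)
  have y: "cosh (D * (\<rho> / \<sigma>)) = y" if "\<not> y < 1"
    using that \<sigma> \<rho> by (simp add: D)
  have "K * (2 * Phi (- D)) - (1 - (Phi (\<rho> / \<sigma> + D) - Phi (\<rho> / \<sigma> - D)))
    \<le> K * measure (normal_law b \<sigma>) B
        - (measure (normal_law (b + \<rho>) \<sigma>) B + measure (normal_law (b - \<rho>) \<sigma>) B) / 2"
  proof (rule two_sided_neyman_pearson[OF \<sigma> D0 B])
    fix z assume z: "D \<le> \<bar>z\<bar>"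
    have "y \<le> cosh (z * (\<rho> / \<sigma>))"
    proof (cases "y < 1")
      case True
      then show ?thesis using cosh_real_ge_1[of "z * (\<rho> / \<sigma>)"] by linarith
    next
      case False
      then show ?thesis using y cosh_mult_le_cosh_mult[of D z "\<rho> / \<sigma>"] z D0 \<sigma> \<rho> by auto
    qed
    then show "K \<le> exp (- \<rho>\<^sup>2 / (2 * \<sigma>\<^sup>2)) * cosh (z * (\<rho> / \<sigma>))"
      unfolding K by (intro mult_left_mono) auto
  next
    fix z assume z: "\<bar>z\<bar> < D"
    \<comment> \<open>For \<open>y < 1\<close> the default \<open>D = 0\<close> leaves no
      \<open>z\<close> in the inner region.\<close>
    then have "\<not> y < 1" by (auto simp: D)
    then have "cosh (z * (\<rho> / \<sigma>)) \<le> y"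
      using y cosh_mult_le_cosh_mult[of z D "\<rho> / \<sigma>"] z D0 \<sigma> \<rho> by auto
    then show "exp (- \<rho>\<^sup>2 / (2 * \<sigma>\<^sup>2)) * cosh (z * (\<rho> / \<sigma>)) \<le> K"
      unfolding K by (intro mult_left_mono) auto
  qed
  moreover have "g_TS \<sigma> n A \<rho> - 1
      = K * (2 * Phi (- D)) - (1 - (Phi (\<rho> / \<sigma> + D) - Phi (\<rho> / \<sigma> - D)))"
    by (simp add: g_TS_def Let_def D_def K_def)
  ultimately show ?thesis by (simp add: K_def)
qed

section \<open>Coverage of a single interval and power of a single selection\<close>

text \<open>The endpoints are functions of one observation, and \<open>t\<close> is both the mean of
  its law and the point to be covered.\<close>

definition coverage :: "real \<Rightarrow> (real \<Rightarrow> real) \<Rightarrow> (real \<Rightarrow> real) \<Rightarrow> real \<Rightarrow> real"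
  where "coverage \<sigma> l u t = measure (normal_law t \<sigma>) {v. t \<in> {l v..u v}}"

lemma coverage_bounds: "\<sigma> > 0 \<Longrightarrow> 0 \<le> coverage \<sigma> l u t \<and> coverage \<sigma> l u t \<le> 1"
  unfolding coverage_def using prob_space.prob_le_1[OF prob_space_normal_density] by simp

text \<open>An interval that covers both \<open>b\<close> and \<open>t\<close> has length at least \<open>\<bar>t - b\<bar>\<close>, which Markov's
  inequality makes unlikely.\<close>

lemma coverage_le_miss_plus_length:
  assumes \<sigma>: "\<sigma> > 0" and l [measurable]: "l \<in> borel_measurable borel"
    and u [measurable]: "u \<in> borel_measurable borel"
    and len: "(\<integral>\<^sup>+v. ennreal (u v - l v) \<partial>normal_law t \<sigma>) \<le> ennreal m"
    and t: "t \<noteq> b" and m: "m \<ge> 0"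
  shows "coverage \<sigma> l u t \<le> measure (normal_law t \<sigma>) {v. b \<notin> {l v..u v}} + m / \<bar>t - b\<bar>"
proof -
  interpret prob_space "normal_law t \<sigma>" by (rule prob_space_normal_density[OF \<sigma>])
  let ?N = "normal_law t \<sigma>" and ?\<rho> = "\<bar>t - b\<bar>"
  let ?W = "{v. ?\<rho> \<le> u v - l v}" and ?B = "{v. b \<notin> {l v..u v}}"
  have W: "?W \<in> sets borel" by measurable
  have B: "?B \<in> sets borel" unfolding atLeastAtMost_iff by measurable
  have \<rho>: "?\<rho> > 0" using t by simp
  have "ennreal ?\<rho> * emeasure ?N ?W = (\<integral>\<^sup>+v. ennreal ?\<rho> * indicator ?W v \<partial>?N)"
    using W by (simp add: nn_integral_cmult_indicator)
  also have "\<dots> \<le> (\<integral>\<^sup>+v. ennreal (u v - l v) \<partial>?N)"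
    by (intro nn_integral_mono) (auto split: split_indicator intro: ennreal_leI)
  finally have "ennreal (?\<rho> * measure ?N ?W) \<le> ennreal m"
    using len \<rho> by (simp add: emeasure_eq_measure ennreal_mult)
  then have W_le: "measure ?N ?W \<le> m / ?\<rho>"
    using m \<rho> by (simp add: field_simps)
  have "coverage \<sigma> l u t \<le> measure ?N (?B \<union> ?W)"
    unfolding coverage_def using B W by (intro finite_measure_mono) auto
  also have "\<dots> \<le> measure ?N ?B + measure ?N ?W"
    using B W by (intro measure_Un_le) auto
  finally show ?thesis using W_le by simp
qed

text \<open>Rejecting \<open>b\<close> when the interval misses it has false rejection probability
  \<open>1 - coverage \<sigma> l u b\<close>. Its miss probability at
  \<open>b \<plusminus> \<rho>\<close> exceeds the noncoverage there by at most
  \<open>m / \<rho>\<close>. Multiplying by \<open>A\<close> clears the denominator of the weight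
  and gives the hypothesis \<open>h\<close> of \<open>product_risk_lower_bound\<close>.\<close>

lemma coverage_tradeoff:
  assumes \<sigma>: "\<sigma> > 0" and \<rho>: "\<rho> > 0" and A: "1 \<le> A" and m: "m \<ge> 0"
    and l [measurable]: "l \<in> borel_measurable borel"
    and u [measurable]: "u \<in> borel_measurable borel"
    and len: "\<And>t. t \<in> {b + \<rho>, b - \<rho>} \<Longrightarrow> (\<integral>\<^sup>+v. ennreal (u v - l v) \<partial>normal_law t \<sigma>) \<le> ennreal m"
  shows "real A * (g_TS \<sigma> n A \<rho> - m / \<rho>) \<le> (real n - real A) * (1 - coverage \<sigma> l u b)
    + real A * (1 - (coverage \<sigma> l u (b + \<rho>) + coverage \<sigma> l u (b - \<rho>)) / 2)"
proof -
  interpret prob_space "normal_law b \<sigma>" by (rule prob_space_normal_density[OF \<sigma>])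
  let ?B = "{v. b \<notin> {l v..u v}}"
  define K where "K = (real n - real A) / real A"
  have B: "?B \<in> sets borel" unfolding atLeastAtMost_iff by measurable
  have "UNIV - ?B = {v. b \<in> {l v..u v}}" by auto
  then have miss: "measure (normal_law b \<sigma>) ?B = 1 - coverage \<sigma> l u b"
    using prob_compl[of ?B] B by (simp add: coverage_def)
  have "coverage \<sigma> l u (b + \<rho>) \<le> measure (normal_law (b + \<rho>) \<sigma>) ?B + m / \<rho>"
    using coverage_le_miss_plus_length[OF \<sigma> l u len[of "b + \<rho>"], of b] \<rho> m by simp
  moreover have "coverage \<sigma> l u (b - \<rho>) \<le> measure (normal_law (b - \<rho>) \<sigma>) ?B + m / \<rho>"
    using coverage_le_miss_plus_length[OF \<sigma> l u len[of "b - \<rho>"], of b] \<rho> m by simp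
  ultimately have "g_TS \<sigma> n A \<rho> - m / \<rho> \<le> K * (1 - coverage \<sigma> l u b)
      + (1 - (coverage \<sigma> l u (b + \<rho>) + coverage \<sigma> l u (b - \<rho>)) / 2)"
    using g_TS_le_testing_error[OF \<sigma> \<rho> B, of n A b, folded K_def] unfolding miss by argo
  then have "real A * (g_TS \<sigma> n A \<rho> - m / \<rho>)
     \<le> real A * (K * (1 - coverage \<sigma> l u b)
      + (1 - (coverage \<sigma> l u (b + \<rho>) + coverage \<sigma> l u (b - \<rho>)) / 2))"
    by (rule mult_left_mono) simp
  also have "\<dots> = (real n - real A) * (1 - coverage \<sigma> l u b)
    + real A * (1 - (coverage \<sigma> l u (b + \<rho>) + coverage \<sigma> l u (b - \<rho>)) / 2)"
    using A by (simp add: distrib_left K_def)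
  finally show ?thesis .
qed

text \<open>Among tests of size at most \<open>1 - \<delta>\<close>, the two-sided one with
  threshold \<open>c\<close> has the largest average power at \<open>a\<close> and
  \<open>- a\<close>, namely \<open>1 - Delta_TS a \<sigma> \<delta>\<close>.\<close>

lemma average_power_le:
  assumes \<sigma>: "\<sigma> > 0" and a: "a > 0" and \<delta>: "0 < \<delta>" "\<delta> < 1" and B: "B \<in> sets borel"
    and level: "measure (normal_law 0 \<sigma>) B \<le> 1 - \<delta>"
  shows "(measure (normal_law a \<sigma>) B + measure (normal_law (- a) \<sigma>) B) / 2 \<le> 1 - Delta_TS a \<sigma> \<delta>"
    and "0 \<le> Delta_TS a \<sigma> \<delta>"
proof -
  define c where "c = inv Phi ((1 + \<delta>) / 2)"
  have c: "Phi c = (1 + \<delta>) / 2" unfolding c_def using \<delta> by (intro Phi_inv_Phi) auto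
  have "Phi 0 = 1 / 2" using Phi_minus[of 0] by simp
  then have c0: "c \<ge> 0" using c \<delta> Phi_mono[of c 0] by (cases "c \<ge> 0") auto
  \<comment> \<open>\<open>K\<close> acts as a Lagrange multiplier: it is the likelihood ratio at
    the boundary \<open>c\<close>. The optimal region has null probability exactly
    \<open>1 - \<delta>\<close>, so the terms with \<open>K\<close> cancel against the size
    constraint.\<close>
  define K where "K = exp (- a\<^sup>2 / (2 * \<sigma>\<^sup>2)) * cosh (c * (a / \<sigma>))"
  have "2 * Phi (- c) = 1 - \<delta>" using c by (simp add: Phi_minus field_simps)
  moreover have "K * (2 * Phi (- c)) - (1 - (Phi (a / \<sigma> + c) - Phi (a / \<sigma> - c)))
    \<le> K * measure (normal_law 0 \<sigma>) B
        - (measure (normal_law (0 + a) \<sigma>) B + measure (normal_law (0 - a) \<sigma>) B) / 2"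
    using \<sigma> a c0 unfolding K_def
    by (intro two_sided_neyman_pearson B mult_left_mono cosh_mult_le_cosh_mult) auto
  moreover have "K * measure (normal_law 0 \<sigma>) B \<le> K * (1 - \<delta>)"
    using level by (intro mult_left_mono) (auto simp: K_def)
  moreover have \<Delta>: "Delta_TS a \<sigma> \<delta> = Phi (a / \<sigma> + c) - Phi (a / \<sigma> - c)"
    by (simp add: Delta_TS_def c_def add.commute)
  ultimately show "(measure (normal_law a \<sigma>) B + measure (normal_law (- a) \<sigma>) B) / 2
      \<le> 1 - Delta_TS a \<sigma> \<delta>"
    by (simp only: add_0 diff_0)
  show "0 \<le> Delta_TS a \<sigma> \<delta>" using Phi_mono[of "a / \<sigma> - c" "a / \<sigma> + c"] c0 by (simp add: \<Delta>)
qed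

section \<open>Joint risk of coordinatewise intervals\<close>

lemma space_gauss [simp]: "space (gauss d \<sigma> \<theta>) = Rd d"
  by (simp add: gauss_def space_PiM)

text \<open>No selector appears: an unselected coordinate has the interval from 0 to 0, so
  membership in \<open>M x\<close> is one interval condition per coordinate. The means allowed in
  \<open>length\<close> are those that a single coordinate of a vector in \<open>Theta d s a\<close>
  can take.\<close>

locale coordinatewise_intervals =
  fixes d s :: nat and a \<sigma> m :: real and l u :: "nat \<Rightarrow> real \<Rightarrow> real"
    and M :: "(nat \<Rightarrow> real) \<Rightarrow> (nat \<Rightarrow> real) set"
  assumes s: "1 \<le> s" "s \<le> d"
    and pos: "0 < a" "0 < \<sigma>" "0 < m"
    and l [measurable]: "\<And>j. j \<in> {1..d} \<Longrightarrow> l j \<in> borel_measurable borel"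
    and u [measurable]: "\<And>j. j \<in> {1..d} \<Longrightarrow> u j \<in> borel_measurable borel"
    and mem_M: "\<And>x \<theta>. x \<in> Rd d \<Longrightarrow> \<theta> \<in> Rd d \<Longrightarrow>
      \<theta> \<in> M x \<longleftrightarrow> (\<forall>j\<in>{1..d}. \<theta> j \<in> {l j (x j)..u j (x j)})"
    and length: "\<And>j t. j \<in> {1..d} \<Longrightarrow> t = 0 \<or> a \<le> \<bar>t\<bar> \<Longrightarrow>
      (\<integral>\<^sup>+v. ennreal (u j v - l j v) \<partial>normal_law t \<sigma>) \<le> ennreal m"
begin

definition risk :: "(nat \<Rightarrow> real) \<Rightarrow> real"
  where "risk \<theta> = measure (gauss d \<sigma> \<theta>) {x \<in> Rd d. \<theta> \<notin> M x}"

definition sup_risk :: real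
  where "sup_risk = (SUP \<theta>\<in>Theta d s a. risk \<theta>)"

lemma risk_eq:
  assumes "\<theta> \<in> Rd d"
  shows "risk \<theta> = 1 - (\<Prod>j\<in>{1..d}. coverage \<sigma> (l j) (u j) (\<theta> j))"
proof -
  interpret product_prob_space "\<lambda>j. normal_law (\<theta> j) \<sigma>" "{1..d}"
    by (intro product_prob_space.intro product_sigma_finite.intro
        product_prob_space_axioms.intro prob_space_imp_sigma_finite prob_space_normal_density pos)
  interpret finite_product_prob_space "\<lambda>j. normal_law (\<theta> j) \<sigma>" "{1..d}"
    by unfold_locales simp
  define B where "B = (\<lambda>j. {v. \<theta> j \<in> {l j v..u j v}})"
  have B: "B j \<in> sets (normal_law (\<theta> j) \<sigma>)" if "j \<in> {1..d}" for j
    unfolding B_def atLeastAtMost_iff using that by measurable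
  \<comment> \<open>The covering event is a rectangle, whose probability factorises over the
    coordinates.\<close>
  have "{x \<in> Rd d. \<theta> \<notin> M x} = space (gauss d \<sigma> \<theta>) - Pi\<^sub>E {1..d} B"
  proof (rule set_eqI)
    fix x
    have "x \<in> Pi\<^sub>E {1..d} B \<longleftrightarrow> x \<in> Rd d \<and> (\<forall>j\<in>{1..d}. x j \<in> B j)"
      unfolding PiE_iff by blast
    then show "x \<in> {x \<in> Rd d. \<theta> \<notin> M x} \<longleftrightarrow> x \<in> space (gauss d \<sigma> \<theta>) - Pi\<^sub>E {1..d} B"
      unfolding space_gauss B_def using mem_M[OF _ assms, of x] by blast
  qed
  moreover have "Pi\<^sub>E {1..d} B \<in> sets (gauss d \<sigma> \<theta>)"
    unfolding gauss_def using B by (intro sets_PiM_I_finite) auto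
  ultimately have "risk \<theta> = 1 - measure (gauss d \<sigma> \<theta>) (Pi\<^sub>E {1..d} B)"
    unfolding risk_def using prob_compl[of "Pi\<^sub>E {1..d} B"] by (simp add: gauss_def)
  also have "measure (gauss d \<sigma> \<theta>) (Pi\<^sub>E {1..d} B) = (\<Prod>j\<in>{1..d}. measure (normal_law (\<theta> j) \<sigma>) (B j))"
    unfolding gauss_def by (rule prob_times[OF B])
  finally show ?thesis by (simp add: B_def coverage_def)
qed

text \<open>Coordinates outside \<open>J\<close> contribute factors at most 1. Risks are bounded by
  1, so the real supremum is a genuine upper bound.\<close>

lemma sup_risk_ge:
  assumes "\<theta> \<in> Theta d s a" and J: "J \<subseteq> {1..d}"
  shows "1 - sup_risk \<le> (\<Prod>j\<in>J. coverage \<sigma> (l j) (u j) (\<theta> j))"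
proof -
  let ?c = "\<lambda>j. coverage \<sigma> (l j) (u j) (\<theta> j)"
  have c: "0 \<le> coverage \<sigma> (l j) (u j) t" "coverage \<sigma> (l j) (u j) t \<le> 1" for j t
    using coverage_bounds pos by blast+
  have "bdd_above (risk ` Theta d s a)"
    by (intro bdd_aboveI[of _ 1]) (auto simp: risk_eq Theta_def intro!: prod_nonneg c)
  with assms have "risk \<theta> \<le> sup_risk"
    unfolding sup_risk_def by (intro cSUP_upper)
  then have "1 - sup_risk \<le> prod ?c {1..d}"
    using assms risk_eq by (simp add: Theta_def)
  also have "\<dots> = prod ?c ({1..d} - J) * prod ?c J"
    using J by (intro prod.subset_diff) auto
  also have "\<dots> \<le> 1 * prod ?c J"
    by (intro mult_right_mono prod_le_1 prod_nonneg) (auto simp: c)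
  finally show ?thesis by simp
qed

text \<open>Common core of the first two bounds. \<open>J\<close> carries the base value
  \<open>b\<close>, and the hypothesis \<open>Theta\<close> says that moving \<open>A\<close> of its
  coordinates by \<open>\<rho>\<close> in either direction stays in the parameter space.\<close>

lemma G_TS_le_sup_risk:
  assumes J: "J \<subseteq> {1..d}" and A: "1 \<le> A" "A \<le> card J" and \<rho>: "0 < \<rho>"
    and len: "a \<le> \<bar>b + \<rho>\<bar>" "a \<le> \<bar>b - \<rho>\<bar>"
    and Theta: "\<And>T \<theta>. T \<subseteq> J \<Longrightarrow> card T = A \<Longrightarrow> \<theta> \<in> Rd d \<Longrightarrow>
      (\<And>j. j \<in> T \<Longrightarrow> \<theta> j \<in> {b + \<rho>, b - \<rho>}) \<Longrightarrow> (\<And>j. j \<in> J - T \<Longrightarrow> \<theta> j = b) \<Longrightarrow>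
      (\<And>j. j \<in> {1..d} - J \<Longrightarrow> \<theta> j = 0) \<Longrightarrow> \<theta> \<in> Theta d s a"
  shows "G_TS \<sigma> (card J) A \<rho> m \<le> sup_risk"
proof -
  let ?c = "\<lambda>j. coverage \<sigma> (l j) (u j)"
  have c: "0 \<le> ?c j t" "?c j t \<le> 1" for j t using coverage_bounds pos by blast+
  have J': "finite J" "J \<noteq> {}" using J A by (auto intro: finite_subset)
  \<comment> \<open>The sign with the smaller coverage is taken in each coordinate; it does no
    better than the average over both signs, which replaces a random sign.\<close>
  define e where "e = (\<lambda>j. if ?c j (b + \<rho>) \<le> ?c j (b - \<rho>) then b + \<rho> else b - \<rho>)"
  have e: "?c j (e j) \<le> (?c j (b + \<rho>) + ?c j (b - \<rho>)) / 2" for j by (simp add: e_def)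
  have "real A * max (g_TS \<sigma> (card J) A \<rho> - m / \<rho>) 0
      / (1 + real A * max (g_TS \<sigma> (card J) A \<rho> - m / \<rho>) 0) \<le> sup_risk"
  proof (rule product_risk_lower_bound[where q = "\<lambda>j. 1 - ?c j b" and r = "\<lambda>j. 1 - ?c j (e j)"])
    fix j assume j: "j \<in> J"
    have "real A * (g_TS \<sigma> (card J) A \<rho> - m / \<rho>) \<le> (real (card J) - real A) * (1 - ?c j b)
        + real A * (1 - (?c j (b + \<rho>) + ?c j (b - \<rho>)) / 2)"
      using j J pos len \<rho> A by (intro coverage_tradeoff l u length) auto
    also have "\<dots> \<le> (real (card J) - real A) * (1 - ?c j b) + real A * (1 - ?c j (e j))"
      using e[of j] by (intro add_left_mono mult_left_mono) auto
    finally show "real A * (g_TS \<sigma> (card J) A \<rho> - m / \<rho>)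
      \<le> (real (card J) - real A) * (1 - ?c j b) + real A * (1 - ?c j (e j))" .
  next
    fix T assume T: "T \<subseteq> J" "card T = A"
    define \<theta> where "\<theta> = (\<lambda>j\<in>{1..d}. if j \<in> T then e j else if j \<in> J then b else 0)"
    have "\<theta> \<in> Theta d s a"
      using T J by (intro Theta[OF T]) (auto simp: \<theta>_def e_def)
    from sup_risk_ge[OF this J] have "1 - sup_risk \<le> (\<Prod>j\<in>J. ?c j (\<theta> j))" .
    also have "\<dots> = (\<Prod>j\<in>J. 1 - (if j \<in> T then 1 - ?c j (e j) else 1 - ?c j b))"
      using J by (intro prod.cong) (auto simp: \<theta>_def)
    finally show "1 - sup_risk \<le> \<dots>" .
  qed (use J' A c in auto)
  then show ?thesis by (simp add: G_TS_def Let_def)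
qed

text \<open>With base 0 only the moved coordinates are nonzero, so all \<open>d\<close> coordinates
  can serve as candidates; \<open>a \<le> \<rho>\<close> makes the moved values admissible.\<close>

lemma G_TS_null_base:
  assumes "a \<le> \<rho>" "1 \<le> A" "A \<le> s"
  shows "G_TS \<sigma> d A \<rho> m \<le> sup_risk"
proof -
  have "G_TS \<sigma> (card {1..d}) A \<rho> m \<le> sup_risk"
  proof (rule G_TS_le_sup_risk[where b = 0])
    show "a \<le> \<bar>0 + \<rho>\<bar>" "a \<le> \<bar>0 - \<rho>\<bar>" "0 < \<rho>" using assms(1) pos(1) by simp_all
    show "{1..d} \<subseteq> {1..d}" "1 \<le> A" "A \<le> card {1..d}" using assms s by simp_all
  next
    fix T \<theta>
    assume T: "T \<subseteq> {1..d}" "card T = A" and \<theta>: "\<theta> \<in> Rd d"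
      "\<And>j. j \<in> T \<Longrightarrow> \<theta> j \<in> {0 + \<rho>, 0 - \<rho>}" "\<And>j. j \<in> {1..d} - T \<Longrightarrow> \<theta> j = 0"
    have "{j \<in> {1..d}. \<theta> j \<noteq> 0} \<subseteq> T" using \<theta> by auto
    then have "card {j \<in> {1..d}. \<theta> j \<noteq> 0} \<le> s"
      using T assms by (metis card_mono finite_atLeastAtMost finite_subset le_trans)
    moreover have "a \<le> \<bar>\<theta> j\<bar>" if "j \<in> {1..d}" "\<theta> j \<noteq> 0" for j
      using \<theta>(2,3)[of j] that assms pos by (cases "j \<in> T") auto
    ultimately show "\<theta> \<in> Theta d s a" using \<theta> by (simp add: Theta_def)
  qed
  then show ?thesis by simp
qed

lemma card_nonzero_le:
  assumes "\<And>j. j \<in> {1..d} - {1..s} \<Longrightarrow> \<theta> j = (0 :: real)"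
  shows "card {j \<in> {1..d}. \<theta> j \<noteq> 0} \<le> s"
proof -
  have "{j \<in> {1..d}. \<theta> j \<noteq> 0} \<subseteq> {1..s}" using assms by blast
  from card_mono[OF _ this] show ?thesis by simp
qed

text \<open>Centring at \<open>a + \<rho>\<close> keeps the base point and both alternatives at least \<open>a\<close> away from \<open>0\<close>, so
  \<open>\<rho>\<close> may be arbitrarily small; the price is that only \<open>s\<close> coordinates are available.\<close>

lemma G_TS_nonnull_base:
  assumes "0 < \<rho>" "1 \<le> B" "B \<le> s"
  shows "G_TS \<sigma> s B \<rho> m \<le> sup_risk"
proof -
  have "G_TS \<sigma> (card {1..s}) B \<rho> m \<le> sup_risk"
  proof (rule G_TS_le_sup_risk[where b = "a + \<rho>"])
    show "a \<le> \<bar>a + \<rho> + \<rho>\<bar>" "a \<le> \<bar>a + \<rho> - \<rho>\<bar>" using assms(1) pos(1) by simp_all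
    show "{1..s} \<subseteq> {1..d}" "1 \<le> B" "B \<le> card {1..s}" "0 < \<rho>" using assms s by simp_all
  next
    fix T \<theta>
    assume T: "T \<subseteq> {1..s}" "card T = B" and \<theta>: "\<theta> \<in> Rd d"
      "\<And>j. j \<in> T \<Longrightarrow> \<theta> j \<in> {a + \<rho> + \<rho>, a + \<rho> - \<rho>}"
      "\<And>j. j \<in> {1..s} - T \<Longrightarrow> \<theta> j = a + \<rho>" "\<And>j. j \<in> {1..d} - {1..s} \<Longrightarrow> \<theta> j = 0"
    have "a \<le> \<bar>\<theta> j\<bar>" if "j \<in> {1..d}" "\<theta> j \<noteq> 0" for j
      using \<theta>(2-4)[of j] that assms pos by (cases "j \<in> T"; cases "j \<in> {1..s}") auto
    with card_nonzero_le[OF \<theta>(4)] show "\<theta> \<in> Theta d s a" using \<theta>(1) by (simp add: Theta_def)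
  qed
  then show ?thesis by simp
qed

text \<open>\<open>B j\<close> plays the role of the selection event. Off it the interval is the
  point 0, so covering a nonzero mean forces \<open>B j\<close>, and coverage at the worse sign is
  at most the average power. Placing that sign on \<open>s\<close> coordinates gives the
  exponent.\<close>

lemma Delta_TS_bound:
  assumes \<delta>: "0 < \<delta>" "\<delta> < 1"
    and B: "\<And>j. j \<in> {1..d} \<Longrightarrow> B j \<in> sets borel"
    and level: "\<And>j. j \<in> {1..d} \<Longrightarrow> measure (normal_law 0 \<sigma>) (B j) \<le> 1 - \<delta>"
    and null: "\<And>j v. j \<in> {1..d} \<Longrightarrow> v \<notin> B j \<Longrightarrow> l j v = 0 \<and> u j v = 0"
  shows "1 - 1 / (Delta_TS a \<sigma> \<delta> + 1) ^ s \<le> sup_risk"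
proof -
  let ?c = "\<lambda>j. coverage \<sigma> (l j) (u j)" and ?\<Delta> = "Delta_TS a \<sigma> \<delta>"
  define e where "e = (\<lambda>j. if ?c j a \<le> ?c j (- a) then a else - a)"
  have d: "1 \<in> {1..d}" using s by simp
  have \<Delta>0: "0 \<le> ?\<Delta>" using average_power_le(2)[OF pos(2,1) \<delta> B[OF d] level[OF d]] .
  have e: "?c j (e j) \<le> 1 / (?\<Delta> + 1)" if j: "j \<in> {1..d}" for j
  proof -
    have power: "?c j t \<le> measure (normal_law t \<sigma>) (B j)" if "t \<noteq> 0" for t
    proof -
      interpret prob_space "normal_law t \<sigma>" by (rule prob_space_normal_density[OF pos(2)])
      show ?thesis unfolding coverage_def
        using null[OF j] that B[OF j] by (intro finite_measure_mono) fastforce+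
    qed
    have "?c j (e j) \<le> (?c j a + ?c j (- a)) / 2" by (simp add: e_def)
    also have "\<dots> \<le> 1 - ?\<Delta>"
      using average_power_le(1)[OF pos(2,1) \<delta> B[OF j] level[OF j]] power[of a] power[of "- a"] pos
      by simp
    \<comment> \<open>This is \<open>1 - ?\<Delta>\<^sup>2 \<le> 1\<close>, divided by a positive
      number.\<close>
    also have "\<dots> \<le> 1 / (?\<Delta> + 1)"
    proof -
      have "(1 - ?\<Delta>) * (?\<Delta> + 1) \<le> 1" by (simp add: algebra_simps)
      then show ?thesis using \<Delta>0 by (subst pos_le_divide_eq) auto
    qed
    finally show ?thesis .
  qed
  define \<theta> where "\<theta> = (\<lambda>j\<in>{1..d}. if j \<in> {1..s} then e j else 0)"
  have "card {j \<in> {1..d}. \<theta> j \<noteq> 0} \<le> s" by (rule card_nonzero_le) (simp add: \<theta>_def)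
  then have "\<theta> \<in> Theta d s a" by (auto simp: Theta_def \<theta>_def e_def split: if_splits)
  then have "1 - sup_risk \<le> (\<Prod>j\<in>{1..s}. ?c j (\<theta> j))"
    using s by (intro sup_risk_ge) auto
  also have "\<dots> \<le> (\<Prod>j\<in>{1..s}. 1 / (?\<Delta> + 1))"
    using e s coverage_bounds[OF pos(2)] by (intro prod_mono) (auto simp: \<theta>_def)
  finally show ?thesis by (simp add: power_divide)
qed

end

section \<open>Reduction of the class \<open>M_class\<close> to functions of one variable\<close>

lemma marginal_normal:
  assumes \<sigma>: "\<sigma> > 0" and j: "j \<in> {1..d}"
  shows "distr (gauss d \<sigma> \<theta>) borel (\<lambda>x. x j) = normal_law (\<theta> j) \<sigma>"
proof -
  interpret product_prob_space "\<lambda>j. normal_law (\<theta> j) \<sigma>" "{1..d}"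
    by (intro product_prob_space.intro product_sigma_finite.intro
        product_prob_space_axioms.intro prob_space_imp_sigma_finite prob_space_normal_density \<sigma>)
  have "distr (gauss d \<sigma> \<theta>) borel (\<lambda>x. x j) = distr (gauss d \<sigma> \<theta>) (normal_law (\<theta> j) \<sigma>) (\<lambda>x. x j)"
    by (rule distr_cong) simp_all
  also have "\<dots> = normal_law (\<theta> j) \<sigma>" unfolding gauss_def by (rule PiM_component[OF j])
  finally show ?thesis .
qed

lemma measurable_gauss_component: "j \<in> {1..d} \<Longrightarrow> (\<lambda>x. x j) \<in> borel_measurable (gauss d \<sigma> \<theta>)"
  using measurable_component_singleton[of j "{1..d}" "\<lambda>j. normal_law (\<theta> j) \<sigma>"]
  by (simp add: gauss_def cong: measurable_cong_sets)

lemma M_class_coordinatewise: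
  assumes s: "1 \<le> s" "s \<le> d" and pos: "0 < a" "0 < \<sigma>" "0 < m"
    and M: "M \<in> M_class d s a \<sigma> m \<delta>"
  obtains l u B where "coordinatewise_intervals d s a \<sigma> m l u M"
    and "\<And>j. j \<in> {1..d} \<Longrightarrow> B j \<in> sets borel"
    and "\<And>j. j \<in> {1..d} \<Longrightarrow> measure (normal_law 0 \<sigma>) (B j) \<le> 1 - \<delta>"
    and "\<And>j v. j \<in> {1..d} \<Longrightarrow> v \<notin> B j \<Longrightarrow> l j v = 0 \<and> u j v = (0 :: real)"
proof -
  from M obtain S U L where M_eq: "M = (\<lambda>x. conf_set d (S x) (U x) (L x))"
    and CI: "(S, U, L) \<in> CI d" and F: "S \<in> F_class d \<sigma> \<delta>"
    and len: "(SUP j\<in>{1..d}. SUP \<theta>\<in>Theta d s a. \<integral>\<^sup>+x. ennreal (U x j - L x j) \<partial>gauss d \<sigma> \<theta>) \<le> ennreal m"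
    by (auto simp: M_class_def)
  have "\<forall>j\<in>{1..d}. \<exists>f. f \<in> borel_measurable borel \<and> (\<forall>x\<in>Rd d. L x j = f (x j))"
    using CI by (auto simp: CI_def depends_only_on_def)
  then obtain l where l: "\<And>j. j \<in> {1..d} \<Longrightarrow> l j \<in> borel_measurable borel"
    "\<And>j x. j \<in> {1..d} \<Longrightarrow> x \<in> Rd d \<Longrightarrow> L x j = l j (x j)" by metis
  have "\<forall>j\<in>{1..d}. \<exists>f. f \<in> borel_measurable borel \<and> (\<forall>x\<in>Rd d. U x j = f (x j))"
    using CI by (auto simp: CI_def depends_only_on_def)
  then obtain u where u: "\<And>j. j \<in> {1..d} \<Longrightarrow> u j \<in> borel_measurable borel"
    "\<And>j x. j \<in> {1..d} \<Longrightarrow> x \<in> Rd d \<Longrightarrow> U x j = u j (x j)" by metis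
  have "\<forall>j\<in>{1..d}. \<exists>f. f \<in> measurable borel (count_space UNIV) \<and> (\<forall>x\<in>Rd d. (j \<in> S x) = f (x j))"
    using F by (auto simp: F_class_def depends_only_on_def)
  then obtain sel where sel: "\<And>j. j \<in> {1..d} \<Longrightarrow> sel j \<in> measurable borel (count_space UNIV)"
    "\<And>j x. j \<in> {1..d} \<Longrightarrow> x \<in> Rd d \<Longrightarrow> j \<in> S x \<longleftrightarrow> sel j (x j)" by metis
  define B where "B = (\<lambda>j. Collect (sel j))"
  have B: "B j \<in> sets borel" if "j \<in> {1..d}" for j
    unfolding B_def using sel(1)[OF that] by (simp add: pred_def)
  \<comment> \<open>Constant vectors realise every real \<open>v\<close> as a \<open>j\<close>-th
    coordinate, so relations between \<open>S\<close>, \<open>L\<close> and \<open>U\<close> pass to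
    \<open>sel\<close>, \<open>l\<close> and \<open>u\<close>.\<close>
  have const: "(\<lambda>i\<in>{1..d}. v) \<in> Rd d" for v :: real by simp
  have null: "l j v = 0 \<and> u j v = 0" if j: "j \<in> {1..d}" and v: "v \<notin> B j" for j v
  proof -
    have "j \<notin> S (\<lambda>i\<in>{1..d}. v)" using v j const by (simp add: sel B_def)
    then have "L (\<lambda>i\<in>{1..d}. v) j = 0 \<and> U (\<lambda>i\<in>{1..d}. v) j = 0"
      using CI j const by (simp add: CI_def)
    then show ?thesis using l(2)[OF j const] u(2)[OF j const] j by simp
  qed
  have level: "measure (normal_law 0 \<sigma>) (B j) \<le> 1 - \<delta>" if j: "j \<in> {1..d}" for j
  proof -
    have "measure (normal_law 0 \<sigma>) (B j)
        = measure (distr (gauss d \<sigma> (\<lambda>i\<in>{1..d}. 0)) borel (\<lambda>x. x j)) (B j)"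
      using j by (simp add: marginal_normal[OF pos(2) j])
    also have "\<dots> = measure (gauss d \<sigma> (\<lambda>i\<in>{1..d}. 0)) ((\<lambda>x. x j) -` B j \<inter> Rd d)"
      by (subst measure_distr) (auto intro: measurable_gauss_component j B)
    also have "(\<lambda>x. x j) -` B j \<inter> Rd d = {x \<in> Rd d. j \<in> S x}"
      using j sel(2)[OF j] by (auto simp: B_def)
    also have "measure (gauss d \<sigma> (\<lambda>i\<in>{1..d}. 0)) \<dots> \<le> 1 - \<delta>"
      using F j by (simp add: F_class_def)
    finally show ?thesis .
  qed
  have "coordinatewise_intervals d s a \<sigma> m l u M"
  proof
    fix x \<theta> assume x: "x \<in> Rd d" and \<theta>: "\<theta> \<in> Rd d"
    have S: "S x \<subseteq> {1..d}" using CI x by (auto simp: CI_def)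
    have out: "L x j = 0 \<and> U x j = 0" if "j \<in> {1..d}" "j \<notin> S x" for j
      using CI x that by (auto simp: CI_def)
    have "\<theta> \<in> M x \<longleftrightarrow> (\<forall>j\<in>{1..d}. \<theta> j \<in> {L x j..U x j})"
    proof
      assume mem: "\<theta> \<in> M x"
      show "\<forall>j\<in>{1..d}. \<theta> j \<in> {L x j..U x j}"
      proof
        fix j assume "j \<in> {1..d}"
        then show "\<theta> j \<in> {L x j..U x j}"
          using mem out[of j] by (cases "j \<in> S x") (auto simp: M_eq conf_set_def)
      qed
    next
      assume mem: "\<forall>j\<in>{1..d}. \<theta> j \<in> {L x j..U x j}"
      have "\<theta> j = 0" if "j \<in> {1..d} - S x" for j
        using mem[rule_format, of j] out[of j] that by simp
      moreover have "\<theta> j \<in> {L x j..U x j}" if "j \<in> S x" for j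
        using mem S that by blast
      ultimately show "\<theta> \<in> M x" using \<theta> by (simp add: M_eq conf_set_def)
    qed
    then show "\<theta> \<in> M x \<longleftrightarrow> (\<forall>j\<in>{1..d}. \<theta> j \<in> {l j (x j)..u j (x j)})"
      using l(2)[OF _ x] u(2)[OF _ x] by simp
  next
    fix j and t :: real assume j: "j \<in> {1..d}" and t: "t = 0 \<or> a \<le> \<bar>t\<bar>"
    \<comment> \<open>A vector with at most one nonzero entry lies in \<open>Theta d s a\<close>
      because \<open>1 \<le> s\<close>, and its \<open>j\<close>-th marginal has mean
      \<open>t\<close>; the length constraint thus applies to \<open>t\<close>.\<close>
    define \<theta> where "\<theta> = (\<lambda>i\<in>{1..d}. if i = j then t else 0)"
    have "{i \<in> {1..d}. \<theta> i \<noteq> 0} \<subseteq> {j}" by (auto simp: \<theta>_def)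
    from card_mono[OF _ this] have "\<theta> \<in> Theta d s a"
      using s t by (auto simp: Theta_def \<theta>_def)
    have "(\<integral>\<^sup>+v. ennreal (u j v - l j v) \<partial>normal_law t \<sigma>)
        = (\<integral>\<^sup>+v. ennreal (u j v - l j v) \<partial>distr (gauss d \<sigma> \<theta>) borel (\<lambda>x. x j))"
      using j by (simp add: marginal_normal[OF pos(2) j] \<theta>_def)
    also have "\<dots> = (\<integral>\<^sup>+x. ennreal (u j (x j) - l j (x j)) \<partial>gauss d \<sigma> \<theta>)"
      using l(1)[OF j] u(1)[OF j] by (intro nn_integral_distr measurable_gauss_component j) simp
    also have "\<dots> = (\<integral>\<^sup>+x. ennreal (U x j - L x j) \<partial>gauss d \<sigma> \<theta>)"
      using l(2)[OF j] u(2)[OF j] by (intro nn_integral_cong) simp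
    also have "\<dots> \<le> (SUP j\<in>{1..d}. SUP \<theta>\<in>Theta d s a. \<integral>\<^sup>+x. ennreal (U x j - L x j) \<partial>gauss d \<sigma> \<theta>)"
      using \<open>\<theta> \<in> Theta d s a\<close> by (intro SUP_upper2[OF j] SUP_upper)
    also note len
    finally show "(\<integral>\<^sup>+v. ennreal (u j v - l j v) \<partial>normal_law t \<sigma>) \<le> ennreal m" .
  qed (use s pos l(1) u(1) in auto)
  with B level null show ?thesis by (rule_tac that)
qed

theorem theorem5p3:
  fixes d s :: nat and a \<sigma> m \<delta> :: real
    and M :: "(nat \<Rightarrow> real) \<Rightarrow> (nat \<Rightarrow> real) set"
  assumes "1 \<le> s" and "s \<le> d"
    and "0 < a" and "0 < \<sigma>" and "0 < m"
    and "0 < \<delta>" and "\<delta> < 1"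
    and "M \<in> M_class d s a \<sigma> m \<delta>"
  shows "(SUP \<theta>\<in>Theta d s a. measure (gauss d \<sigma> \<theta>) {x \<in> Rd d. \<theta> \<notin> M x})
    \<ge> max (SUP (\<rho>, A)\<in>{a..} \<times> {1..s}. G_TS \<sigma> d A \<rho> m)
       (max (SUP (\<rho>, B)\<in>{0<..} \<times> {1..s}. G_TS \<sigma> s B \<rho> m)
            (1 - 1 / (Delta_TS a \<sigma> \<delta> + 1) ^ s))"
proof -
  obtain l u B where "coordinatewise_intervals d s a \<sigma> m l u M"
    and B: "\<And>j. j \<in> {1..d} \<Longrightarrow> B j \<in> sets borel"
      "\<And>j. j \<in> {1..d} \<Longrightarrow> measure (normal_law 0 \<sigma>) (B j) \<le> 1 - \<delta>"
      "\<And>j v. j \<in> {1..d} \<Longrightarrow> v \<notin> B j \<Longrightarrow> l j v = 0 \<and> u j v = 0"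
    using M_class_coordinatewise[OF assms(1-5,8)] by metis
  then interpret coordinatewise_intervals d s a \<sigma> m l u M by simp
  \<comment> \<open>\<open>1 \<le> s\<close> makes the index set nonempty, as
    \<open>cSUP_least\<close> requires for real suprema.\<close>
  have "(SUP (\<rho>, A)\<in>{a..} \<times> {1..s}. G_TS \<sigma> d A \<rho> m) \<le> sup_risk"
    using s by (intro cSUP_least) (auto intro: G_TS_null_base)
  moreover have "(SUP (\<rho>, B)\<in>{0<..} \<times> {1..s}. G_TS \<sigma> s B \<rho> m) \<le> sup_risk"
    using s by (intro cSUP_least) (auto intro: G_TS_nonnull_base)
  moreover have "1 - 1 / (Delta_TS a \<sigma> \<delta> + 1) ^ s \<le> sup_risk"
    using Delta_TS_bound[OF assms(6,7) B] .
  ultimately show ?thesis by (simp add: sup_risk_def risk_def)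
qed

end
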